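(* Assume $\mathrm{supp}(P^c)\cap\mathrm{supp}(P^n)=\emptyset$, and let $P^m=\alpha P^n+(1-\alpha)P^c$. Let $h^*$ be a model trained on $P^c$, with $\mathcal{L}_{ntp}(P^c,h^* )=-\log p_c$ and $\mathcal{L}_{ntp}(P^n,h^* )=-\log p_n$. When the model $h$ is trained on the mixed distribution $P^m$, which includes noise, it attempts to fit $P^n$, leading to an increase in the loss on the clean distribution $P^c$, such that $$\mathcal{L}_{ntp}(P^c,h)=-\log(p_c-\epsilon),\qquad \mathcal{L}_{ntp}(P^n,h)=-\log(p_n+\epsilon/k)$$ for some $\epsilon>0$, where $k$ can be shown to be $\Omega\big(e^{\mathcal{L}_{ntp}(P^n,h)}\big)$. Let $\eta=\alpha p_c-(1-\alpha)kp_n$. Then: (1) If $\alpha\le\frac{kp_n}{p_c+kp_n}$, then for any $0<\epsilon<p_c$ we have $\mathcal{L}_{ntp}(P^m,h)\ge\mathcal{L}_{ntp}(P^m,h^* )$. That is, when $\alpha$ is sufficiently small, the global minimum on $P^m$ will not be affected by noise. (2) If $\alpha>\frac{kp_n}{p_c+kp_n}$, then for $\epsilon<\eta$ it holds that $\mathcal{L}_{ntp}(P^m,h)<\mathcal{L}_{ntp}(P^m,h^* )$. This suggests that if $\alpha$ is large enough, the impact on the optimal hypothesis is at least as much as $\alpha p_c-(1-\alpha)kp_n$. (3) When $\alpha<\frac13$ and $k>\frac{\alpha(1-3\alpha)p_c}{(1-\alpha)(2-3\alpha)p_n}$, for $\epsilon\ge3\eta$ we get $\mathcal{L}_{ntp}(P^m,h^*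 )<\mathcal{L}_{ntp}(P^m,h)$. Similarly, it can be shown that $\epsilon$ does not exceed $2\eta$ when $\alpha>\max\left(\frac{kp_n}{p_c+kp_n},\frac12\right)$ and $k>\frac{(2\alpha-1)p_c}{2(1-\alpha)p_n}$. This indicates that when $k$ is sufficiently large, the effect of noise is at most $\mathcal{O}(\alpha p_c-(1-\alpha)kp_n)$.
   Context: Let $\mathcal{W}$ be the vocabulary, with $V=|\mathcal{W}|$ tokens, let $L$ be the maximum context length, and let $\mathcal{X}=\bigcup_{i=1}^{L}\mathcal{W}^i$ be the set of prefixes. For a discrete set $A$, $\Delta_A$ denotes the set of probability distributions on $A$. For $P\in\Delta_{\mathcal{X}\times\mathcal{W}}$, $P_X$ denotes the marginal on $\mathcal{X}$, $P_{\cdot|x}$ the conditional distribution on $\mathcal{W}$ given $x$, and $\mathrm{supp}(P)$ the support of $P$. $P^c,P^n,P^m\in\Delta_{\mathcal{X}\times\mathcal{W}}$ are the distributions of clean data, noise data and the mixed pre-training data respectively, and $\alpha$ is the noise proportion. $\mathcal{H}$ is the hypothesis space (e.g. all possible parameters of a given transformer architecture); a language model is a map $h:\mathcal{X}\to\mathbb{R}^V$ in $\mathcal{H}$, and $\boldsymbol{p}^h_{\cdot|x}(w)$ is the $w$-th component of the probability distribution induced by $h(x)$. The next-token prediction loss is $$\mathcal{L}_{ntp}(P,h)=\mathbb{E}_{x\sim P_X}\,\mathbb{E}_{w\sim P_{\cdot|x}}\big[-\log\boldsymbol{p}^h_{\cdot|x}(w)\big].$$ The quantities $p_c,p_n,\epsilon,k$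 are real numbers defined by the four loss equalities in the claim; $\epsilon$ measures the damage done by noise to the performance on $P^c$. In the bound $k=\Omega(e^{\mathcal{L}_{ntp}(P^n,h)})$ the factor multiplying $e^{\mathcal{L}_{ntp}(P^n,h)}$ depends only on $P^c$, $h$ and $h^*$. *)

theory Defs
  imports "HOL-Probability.Probability"
begin

text \<open>The vocabulary is a finite type \<open>'w\<close>, so that \<open>V = CARD('w)\<close> and \<open>real ^ 'w\<close> is
  \<open>\<real>\<^sup>V\<close> with components indexed by tokens. Values of a model outside
  \<open>prefixes_upto L\<close> never matter, as all data distributions live on these prefixes.\<close>

type_synonym 'w model = "'w list \<Rightarrow> real ^ 'w"

definition prefixes_upto :: "nat \<Rightarrow> 'w list set" where
  "prefixes_upto L = (\<Union>i\<in>{1..L}. {x. length x = i})"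

definition data_dist :: "nat \<Rightarrow> ('w list \<times> 'w) pmf \<Rightarrow> bool" where
  "data_dist L P \<longleftrightarrow> set_pmf P \<subseteq> prefixes_upto L \<times> UNIV"

definition prefix_marginal :: "('w list \<times> 'w) pmf \<Rightarrow> 'w list pmf" where
  "prefix_marginal P = map_pmf fst P"

text \<open>Meaningful only for \<open>x\<close> in the support of the marginal, where the conditioning
  event has positive probability.\<close>

definition next_token_cond :: "('w list \<times> 'w) pmf \<Rightarrow> 'w list \<Rightarrow> 'w pmf" where
  "next_token_cond P x = map_pmf snd (cond_pmf P {z. fst z = x})"

definition softmax :: "real ^ 'w::finite \<Rightarrow> real ^ 'w" where
  "softmax z = (\<chi> w. exp (z $ w) / (\<Sum>v\<in>UNIV. exp (z $ v)))"

lemma softmax_pos: "softmax z $ w > 0"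
  by (simp add: softmax_def sum_pos)

lemma softmax_sum: "(\<Sum>w\<in>UNIV. softmax z $ w) = 1"
proof -
  have "(\<Sum>v\<in>UNIV. exp (z $ v)) > 0"
    by (simp add: sum_pos)
  then show ?thesis
    by (simp add: softmax_def flip: sum_divide_distrib)
qed

definition ntp_loss :: "('w::finite list \<times> 'w) pmf \<Rightarrow> 'w model \<Rightarrow> real" where
  "ntp_loss P h =
     measure_pmf.expectation (prefix_marginal P) (\<lambda>x.
       measure_pmf.expectation (next_token_cond P x) (\<lambda>w. - ln (softmax (h x) $ w)))"

end

theory Submission
  imports Defs
begin

text \<open>
  Writing \<open>a = p_c\<close> and \<open>b = k p_n\<close>, the excess loss of \<open>h\<close> over \<open>h*\<close> on the mixture is
  \<open>D \<epsilon> = - \<alpha> ln (1 + \<epsilon> / b) - (1 - \<alpha>) ln (1 - \<epsilon> / a)\<close>, with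
  \<open>D' x = (x - \<eta>) / ((b + x) (a - x))\<close>. So \<open>D\<close> starts at \<open>0\<close>, decreases up to \<open>\<eta>\<close> and
  increases afterwards, which gives (1) and (2). For (3) it remains to see that \<open>D (c \<eta>) > 0\<close>
  for \<open>c = 2, 3\<close>. Put \<open>m = \<alpha> (a + b)\<close> and \<open>n = (1 - \<alpha>) (a + b)\<close>, so that \<open>b = m - \<eta>\<close> and
  \<open>a = n + \<eta>\<close>. With \<open>m\<close>, \<open>n\<close> kept fixed, \<open>D (c \<eta>)\<close> becomes a function of \<open>\<eta>\<close> alone that
  vanishes at \<open>0\<close>, and its derivative is positive by the bound on \<open>k\<close> if \<open>c = 3\<close> and because
  \<open>m > n\<close> if \<open>c = 2\<close>. The constant in \<open>k = \<Omega> (e ^ L)\<close>, where \<open>L\<close> is the loss of \<open>h\<close> on the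
  noise, can be taken to be \<open>\<epsilon>\<close>, as \<open>k e ^ (- L) = k p_n + \<epsilon> \<ge> \<epsilon>\<close>.
\<close>

section \<open>The next-token loss as a finite sum, affine in the data distribution\<close>

lemma finite_prefixes_upto: "finite (prefixes_upto L :: 'w::finite list set)"
proof -
  have "finite {xs :: 'w list. set xs \<subseteq> UNIV \<and> length xs \<le> L}"
    by (rule finite_lists_length_le) simp
  then show ?thesis
    by (rule finite_subset[rotated]) (auto simp: prefixes_upto_def)
qed

text \<open>Disintegration of \<open>P\<close> along \<open>f\<close>; with \<open>f = fst\<close>
  it collapses the two nested expectations in \<open>ntp_loss\<close>.\<close>

lemma bind_marginal_cond_pmf:
  "bind_pmf (map_pmf f P) (\<lambda>x. cond_pmf P {z. f z = x}) = P"
proof -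
  have "bind_pmf (map_pmf f P) (\<lambda>x. cond_pmf P {z. x = f z}) = P"
    by (rule bind_cond_pmf_cancel) (auto simp: vimage_def eq_commute)
  then show ?thesis
    by (simp add: eq_commute)
qed

text \<open>The tower property. It removes the conditional distributions, which do not depend
  linearly on \<open>P\<close>. With finite support all expectations are finite sums, so
  integrability is never an issue.\<close>

lemma ntp_loss_eq_expectation:
  assumes "finite (set_pmf P)"
  shows "ntp_loss P h = measure_pmf.expectation P (\<lambda>(x, w). - ln (softmax (h x) $ w))"
proof -
  let ?l = "\<lambda>(x, w). - ln (softmax (h x) $ w)"
  have fin: "finite (set_pmf (cond_pmf P {z. fst z = x}))" if "x \<in> fst ` set_pmf P" for x
    using that assms by (subst set_cond_pmf) auto
  \<comment> \<open>\<open>next_token_cond\<close> forgets the prefix, but under the conditioning it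
    is almost surely \<open>x\<close>, so it can be restored in the integrand.\<close>
  have inner: "measure_pmf.expectation (next_token_cond P x) (\<lambda>w. - ln (softmax (h x) $ w)) =
      measure_pmf.expectation (cond_pmf P {z. fst z = x}) ?l" if "x \<in> fst ` set_pmf P" for x
  proof -
    have "set_pmf P \<inter> {z. fst z = x} \<noteq> {}"
      using that by auto
    then show ?thesis
      unfolding next_token_cond_def integral_map_pmf
      by (intro integral_cong_AE) (auto simp: AE_measure_pmf_iff)
  qed
  have "measure_pmf.expectation P ?l =
      (\<Sum>x\<in>fst ` set_pmf P. pmf (map_pmf fst P) x *
        measure_pmf.expectation (cond_pmf P {z. fst z = x}) ?l)"
    using pmf_expectation_bind[of "fst ` set_pmf P" "\<lambda>x. cond_pmf P {z. fst z = x}"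
        "map_pmf fst P" ?l] assms fin
    by (simp add: bind_marginal_cond_pmf)
  also have "\<dots> = ntp_loss P h"
    unfolding ntp_loss_def prefix_marginal_def using assms inner
    by (subst integral_measure_pmf[of "fst ` set_pmf P"]) auto
  finally show ?thesis ..
qed

text \<open>The index set depends on \<open>L\<close> alone and not on the support of
  \<open>P\<close>, so losses under different distributions combine termwise.\<close>

lemma ntp_loss_eq_sum:
  fixes P :: "('w::finite list \<times> 'w) pmf"
  assumes "data_dist L P"
  shows "ntp_loss P h =
    (\<Sum>z\<in>prefixes_upto L \<times> UNIV. pmf P z * (case z of (x, w) \<Rightarrow> - ln (softmax (h x) $ w)))"
proof -
  have fin: "finite (prefixes_upto L \<times> UNIV :: ('w list \<times> 'w) set)"
    by (simp add: finite_prefixes_upto)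
  have sub: "set_pmf P \<subseteq> prefixes_upto L \<times> UNIV"
    using assms by (simp add: data_dist_def)
  show ?thesis
    unfolding ntp_loss_eq_expectation[OF finite_subset[OF sub fin]]
    using sub by (subst integral_measure_pmf[OF fin]) auto
qed

lemma ntp_loss_mixture:
  assumes "data_dist L P" "data_dist L Q" "data_dist L R"
    and "\<And>z. pmf R z = \<alpha> * pmf P z + (1 - \<alpha>) * pmf Q z"
  shows "ntp_loss R h = \<alpha> * ntp_loss P h + (1 - \<alpha>) * ntp_loss Q h"
  by (simp add: ntp_loss_eq_sum[OF assms(1)] ntp_loss_eq_sum[OF assms(2)]
      ntp_loss_eq_sum[OF assms(3)] assms(4) sum_distrib_left sum.distrib distrib_right mult.assoc)

section \<open>Monotonicity of the excess loss on either side of \<eta>\<close>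

definition excess :: "real \<Rightarrow> real \<Rightarrow> real \<Rightarrow> real \<Rightarrow> real" where
  "excess \<alpha> a b x = \<alpha> * (ln b - ln (b + x)) + (1 - \<alpha>) * (ln a - ln (a - x))"

lemma excess_0 [simp]: "excess \<alpha> a b 0 = 0"
  by (simp add: excess_def)

lemma has_real_derivative_excess:
  assumes "0 < b" "0 \<le> x" "x < a"
  shows "(excess \<alpha> a b has_real_derivative
    (x - (\<alpha> * a - (1 - \<alpha>) * b)) / ((b + x) * (a - x))) (at x)"
proof -
  have pos: "0 < b + x" "0 < a - x"
    using assms by auto
  then have "(excess \<alpha> a b has_real_derivative
      \<alpha> * (- 1 / (b + x)) + (1 - \<alpha>) * (1 / (a - x))) (at x)"
    unfolding excess_def by (auto intro!: derivative_eq_intros)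
  moreover have "\<alpha> * (- 1 / (b + x)) + (1 - \<alpha>) * (1 / (a - x)) =
      (x - (\<alpha> * a - (1 - \<alpha>) * b)) / ((b + x) * (a - x))"
    using pos by (simp add: divide_simps) algebra
  ultimately show ?thesis by simp
qed

lemma continuous_on_excess:
  assumes "0 < b" "0 \<le> x" "y < a"
  shows "continuous_on {x..y} (excess \<alpha> a b)"
  using assms
  by (intro continuous_at_imp_continuous_on ballI DERIV_isCont[OF has_real_derivative_excess]) auto

text \<open>Below \<eta> the numerator of the derivative is negative. Only interior points are
  tested, so \<open>y\<close> may be \<eta> itself, where the derivative vanishes.\<close>

lemma excess_strict_decreasing:
  assumes "0 < b" "0 \<le> x" "x < y" "y < a" "y \<le> \<alpha> * a - (1 - \<alpha>) * b"
  shows "excess \<alpha> a b y < excess \<alpha> a b x"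
proof (rule DERIV_neg_imp_decreasing_open[OF \<open>x < y\<close>])
  show "continuous_on {x..y} (excess \<alpha> a b)"
    using assms by (intro continuous_on_excess)
next
  fix t assume "x < t" "t < y"
  then show "\<exists>d. (excess \<alpha> a b has_real_derivative d) (at t) \<and> d < 0"
    using assms
    by (intro exI[of _ "(t - (\<alpha> * a - (1 - \<alpha>) * b)) / ((b + t) * (a - t))"] conjI
        has_real_derivative_excess divide_neg_pos mult_pos_pos) auto
qed

lemma excess_strict_increasing:
  assumes "0 < b" "0 \<le> x" "x < y" "y < a" "\<alpha> * a - (1 - \<alpha>) * b \<le> x"
  shows "excess \<alpha> a b x < excess \<alpha> a b y"
proof (rule DERIV_pos_imp_increasing_open[OF \<open>x < y\<close>])
  show "continuous_on {x..y} (excess \<alpha> a b)"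
    using assms by (intro continuous_on_excess)
next
  fix t assume "x < t" "t < y"
  then show "\<exists>d. (excess \<alpha> a b has_real_derivative d) (at t) \<and> d > 0"
    using assms
    by (intro exI[of _ "(t - (\<alpha> * a - (1 - \<alpha>) * b)) / ((b + t) * (a - t))"] conjI
        has_real_derivative_excess divide_pos_pos mult_pos_pos) auto
qed

lemma excess_mono:
  assumes "0 < b" "0 \<le> x" "x \<le> y" "y < a" "\<alpha> * a - (1 - \<alpha>) * b \<le> x"
  shows "excess \<alpha> a b x \<le> excess \<alpha> a b y"
  using excess_strict_increasing[of b x y a \<alpha>] assms by (cases "x = y") auto

section \<open>Positivity of the excess loss at three and two times \<eta>\<close>

text \<open>For \<open>u > 0\<close> the derivative has the sign of
  \<open>m * n - 2 * u * (n - m)\<close>. This is affine in \<open>u\<close> and positive at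
  \<open>0\<close> and at \<open>t\<close>, hence in between.\<close>

lemma weighted_log_pos_triple:
  fixes m n t :: real
  assumes "0 < t" "t < m" "2 * t < n" "2 * t * (n - m) < m * n"
  shows "0 < m * (ln (m - t) - ln (m + 2 * t)) + n * (ln (n + t) - ln (n - 2 * t))"
proof -
  let ?f = "\<lambda>u. m * (ln (m - u) - ln (m + 2 * u)) + n * (ln (n + u) - ln (n - 2 * u))"
  let ?d = "\<lambda>u. 3 * ((m + n) * (m * n - 2 * u * (n - m)) * u) /
    ((n + u) * (n - 2 * u) * ((m - u) * (m + 2 * u)))"
  have deriv: "(?f has_real_derivative ?d u) (at u)" if u: "0 \<le> u" "u \<le> t" for u
  proof -
    have pos: "0 < m - u" "0 < m + 2 * u" "0 < n + u" "0 < n - 2 * u"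
      using u assms by auto
    have "m * (- 1 / (m - u) - 2 / (m + 2 * u)) + n * (1 / (n + u) + 2 / (n - 2 * u)) = ?d u"
      using pos by (simp add: divide_simps) algebra
    moreover have "(?f has_real_derivative
        m * (- 1 / (m - u) - 2 / (m + 2 * u)) + n * (1 / (n + u) + 2 / (n - 2 * u))) (at u)"
      using pos by (auto intro!: derivative_eq_intros)
    ultimately show ?thesis by simp
  qed
  have "?f 0 < ?f t"
  proof (rule DERIV_pos_imp_increasing_open[OF \<open>0 < t\<close>])
    show "continuous_on {0..t} ?f"
      using deriv by (intro DERIV_atLeastAtMost_imp_continuous_on exI) auto
  next
    fix u assume u: "0 < u" "u < t"
    have "2 * u * (n - m) < m * n"
    proof (cases "n \<le> m")
      case True
      have "2 * u * (n - m) \<le> 0"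
        using True u by (intro mult_nonneg_nonpos) auto
      also have "0 < m * n"
        using assms by (intro mult_pos_pos) auto
      finally show ?thesis .
    next
      case False
      have "2 * u * (n - m) \<le> 2 * t * (n - m)"
        using False u by (intro mult_right_mono) auto
      with assms show ?thesis by simp
    qed
    then have "0 < ?d u"
      using u assms by (intro divide_pos_pos mult_pos_pos) auto
    with deriv[of u] u show "\<exists>d. (?f has_real_derivative d) (at u) \<and> d > 0"
      by auto
  qed
  then show ?thesis by simp
qed

text \<open>The derivative is \<open>2 * n\<^sup>2 / (n\<^sup>2 - u\<^sup>2) - 2 * m\<^sup>2 /
  (m\<^sup>2 - u\<^sup>2)\<close>, so for \<open>0 < u < n\<close> its sign is that of
  \<open>m - n\<close>.\<close>

lemma weighted_log_pos_double:
  fixes m n t :: real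
  assumes "0 < t" "t < n" "n < m"
  shows "0 < m * (ln (m - t) - ln (m + t)) + n * (ln (n + t) - ln (n - t))"
proof -
  let ?f = "\<lambda>u. m * (ln (m - u) - ln (m + u)) + n * (ln (n + u) - ln (n - u))"
  let ?d = "\<lambda>u. 2 * ((m + n) * (m - n) * u\<^sup>2) / ((n + u) * (n - u) * ((m - u) * (m + u)))"
  have deriv: "(?f has_real_derivative ?d u) (at u)" if u: "0 \<le> u" "u \<le> t" for u
  proof -
    have pos: "0 < m - u" "0 < m + u" "0 < n + u" "0 < n - u"
      using u assms by auto
    have "m * (- 1 / (m - u) - 1 / (m + u)) + n * (1 / (n + u) + 1 / (n - u)) = ?d u"
      using pos by (simp add: divide_simps) algebra
    moreover have "(?f has_real_derivative
        m * (- 1 / (m - u) - 1 / (m + u)) + n * (1 / (n + u) + 1 / (n - u))) (at u)"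
      using pos by (auto intro!: derivative_eq_intros)
    ultimately show ?thesis by simp
  qed
  have "?f 0 < ?f t"
  proof (rule DERIV_pos_imp_increasing_open[OF \<open>0 < t\<close>])
    show "continuous_on {0..t} ?f"
      using deriv by (intro DERIV_atLeastAtMost_imp_continuous_on exI) auto
  next
    fix u assume u: "0 < u" "u < t"
    then have "0 < ?d u"
      using assms by (intro divide_pos_pos mult_pos_pos) auto
    with deriv[of u] u show "\<exists>d. (?f has_real_derivative d) (at u) \<and> d > 0"
      by auto
  qed
  then show ?thesis by simp
qed

lemma excess_triple_pos:
  assumes "0 < a" "0 < b" and \<eta>: "\<eta> = \<alpha> * a - (1 - \<alpha>) * b"
    and "0 < \<eta>" "3 * \<eta> < a"
    and "\<alpha> * (1 - 3 * \<alpha>) * a < (1 - \<alpha>) * (2 - 3 * \<alpha>) * b"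
  shows "0 < excess \<alpha> a b (3 * \<eta>)"
proof -
  define s where "s = a + b"
  have "0 < s"
    using assms by (simp add: s_def)
  have subst: "\<alpha> * s - \<eta> = b" "\<alpha> * s + 2 * \<eta> = b + 3 * \<eta>"
    "(1 - \<alpha>) * s + \<eta> = a" "(1 - \<alpha>) * s - 2 * \<eta> = a - 3 * \<eta>"
    by (simp_all add: s_def \<eta> algebra_simps)
  \<comment> \<open>Inserting \<eta> and collecting the coefficients of \<open>a\<close> and
    \<open>b\<close> gives exactly the factors \<open>1 - 3 * \<alpha>\<close> and
    \<open>2 - 3 * \<alpha>\<close> of the hypothesis. Multiplied by \<open>s\<close>, this is the
    condition \<open>2 * t * (n - m) < m * n\<close>.\<close>
  have "2 * \<eta> * (1 - 2 * \<alpha>) < \<alpha> * (1 - \<alpha>) * s"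
    using assms(6) by (simp add: s_def \<eta> algebra_simps)
  then have "s * (2 * \<eta> * (1 - 2 * \<alpha>)) < s * (\<alpha> * (1 - \<alpha>) * s)"
    using \<open>0 < s\<close> by simp
  then have "2 * \<eta> * ((1 - \<alpha>) * s - \<alpha> * s) < \<alpha> * s * ((1 - \<alpha>) * s)"
    by (simp add: algebra_simps)
  moreover have "\<eta> < \<alpha> * s" "2 * \<eta> < (1 - \<alpha>) * s"
    using subst assms by linarith+
  ultimately have "0 < \<alpha> * s * (ln b - ln (b + 3 * \<eta>)) + (1 - \<alpha>) * s * (ln a - ln (a - 3 * \<eta>))"
    using weighted_log_pos_triple[of \<eta> "\<alpha> * s" "(1 - \<alpha>) * s"] \<open>0 < \<eta>\<close>
    unfolding subst by blast
  also have "\<dots> = s * excess \<alpha> a b (3 * \<eta>)"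
    by (simp add: excess_def algebra_simps)
  finally show ?thesis
    using \<open>0 < s\<close> by (simp add: zero_less_mult_iff)
qed

text \<open>After rescaling by \<open>a + b\<close>, the hypothesis \<open>1 / 2 < \<alpha>\<close>
  says \<open>n < m\<close>, and \<open>2 * \<eta> < a\<close> keeps the logarithms in their
  domain.\<close>

lemma excess_double_pos:
  assumes "0 < a" "0 < b" and \<eta>: "\<eta> = \<alpha> * a - (1 - \<alpha>) * b"
    and "0 < \<eta>" "2 * \<eta> < a" "1 / 2 < \<alpha>"
  shows "0 < excess \<alpha> a b (2 * \<eta>)"
proof -
  define s where "s = a + b"
  have "0 < s"
    using assms by (simp add: s_def)
  have subst: "\<alpha> * s - \<eta> = b" "\<alpha> * s + \<eta> = b + 2 * \<eta>"
    "(1 - \<alpha>) * s + \<eta> = a" "(1 - \<alpha>) * s - \<eta> = a - 2 * \<eta>"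
    by (simp_all add: s_def \<eta> algebra_simps)
  have "(1 - \<alpha>) * s < \<alpha> * s"
    using \<open>0 < s\<close> assms by (intro mult_strict_right_mono) auto
  moreover have "\<eta> < (1 - \<alpha>) * s"
    using subst assms by linarith
  ultimately have "0 < \<alpha> * s * (ln b - ln (b + 2 * \<eta>)) + (1 - \<alpha>) * s * (ln a - ln (a - 2 * \<eta>))"
    using weighted_log_pos_double[of \<eta> "(1 - \<alpha>) * s" "\<alpha> * s"] \<open>0 < \<eta>\<close>
    unfolding subst by blast
  also have "\<dots> = s * excess \<alpha> a b (2 * \<eta>)"
    by (simp add: excess_def algebra_simps)
  finally show ?thesis
    using \<open>0 < s\<close> by (simp add: zero_less_mult_iff)
qed

section \<open>Comparison of \<open>h\<close> and \<open>hstar\<close> on the mixture\<close>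

theorem proposition1:
  fixes L :: nat
    and H :: "'w::finite model set"
    and Pc :: "('w list \<times> 'w) pmf"
    and h hstar :: "'w model"
    and p_c \<epsilon> :: real
  assumes "data_dist L Pc"
    and "hstar \<in> H" and "h \<in> H"
    and "0 < p_c" and "ntp_loss Pc hstar = - ln p_c"
    and "0 < \<epsilon>" and "\<epsilon> < p_c" and "ntp_loss Pc h = - ln (p_c - \<epsilon>)"
  shows "\<exists>C>0. \<forall>(Pn :: ('w list \<times> 'w) pmf) (Pm :: ('w list \<times> 'w) pmf)
      (\<alpha> :: real) (p_n :: real) (k :: real).
    data_dist L Pn \<and> set_pmf Pc \<inter> set_pmf Pn = {} \<and>
    0 \<le> \<alpha> \<and> \<alpha> \<le> 1 \<and>
    data_dist L Pm \<and> (\<forall>z. pmf Pm z = \<alpha> * pmf Pn z + (1 - \<alpha>) * pmf Pc z) \<and>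
    0 < p_n \<and> ntp_loss Pn hstar = - ln p_n \<and>
    0 < p_n + \<epsilon> / k \<and> ntp_loss Pn h = - ln (p_n + \<epsilon> / k) \<and>
    ntp_loss Pn h < ntp_loss Pn hstar
    \<longrightarrow>
    (let \<eta> = \<alpha> * p_c - (1 - \<alpha>) * k * p_n in
      k \<ge> C * exp (ntp_loss Pn h) \<and>
      (\<alpha> \<le> k * p_n / (p_c + k * p_n) \<longrightarrow> ntp_loss Pm h \<ge> ntp_loss Pm hstar) \<and>
      (\<alpha> > k * p_n / (p_c + k * p_n) \<longrightarrow> \<epsilon> < \<eta> \<longrightarrow> ntp_loss Pm h < ntp_loss Pm hstar) \<and>
      (\<alpha> < 1 / 3 \<longrightarrow> k > \<alpha> * (1 - 3 * \<alpha>) * p_c / ((1 - \<alpha>) * (2 - 3 * \<alpha>) * p_n) \<longrightarrow>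
        \<epsilon> \<ge> 3 * \<eta> \<longrightarrow> ntp_loss Pm hstar < ntp_loss Pm h) \<and>
      (\<alpha> > max (k * p_n / (p_c + k * p_n)) (1 / 2) \<longrightarrow>
        k > (2 * \<alpha> - 1) * p_c / (2 * (1 - \<alpha>) * p_n) \<longrightarrow>
        (\<epsilon> \<ge> 2 * \<eta> \<longrightarrow> ntp_loss Pm hstar < ntp_loss Pm h) \<and>
        ((\<forall>g\<in>H. ntp_loss Pm h \<le> ntp_loss Pm g) \<longrightarrow> \<epsilon> \<le> 2 * \<eta>)))"
proof (intro exI[of _ \<epsilon>] conjI allI impI)
  \<comment> \<open>The constant must precede the noise, the mixture and \<open>k\<close>. The
    number \<epsilon> qualifies: it is
    \<open>exp (- ntp_loss Pc hstar) - exp (- ntp_loss Pc h)\<close>.\<close>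
  show "0 < \<epsilon>" by fact
next
  fix Pn Pm :: "('w list \<times> 'w) pmf" and \<alpha> p_n k :: real
  assume A: "data_dist L Pn \<and> set_pmf Pc \<inter> set_pmf Pn = {} \<and>
    0 \<le> \<alpha> \<and> \<alpha> \<le> 1 \<and>
    data_dist L Pm \<and> (\<forall>z. pmf Pm z = \<alpha> * pmf Pn z + (1 - \<alpha>) * pmf Pc z) \<and>
    0 < p_n \<and> ntp_loss Pn hstar = - ln p_n \<and>
    0 < p_n + \<epsilon> / k \<and> ntp_loss Pn h = - ln (p_n + \<epsilon> / k) \<and>
    ntp_loss Pn h < ntp_loss Pn hstar"
  define b where "b = k * p_n"
  define \<eta> where "\<eta> = \<alpha> * p_c - (1 - \<alpha>) * k * p_n"
  have \<eta>_b: "\<eta> = \<alpha> * p_c - (1 - \<alpha>) * b"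
    by (simp add: \<eta>_def b_def)
  \<comment> \<open>Since \<open>h\<close> has the smaller loss on the noise,
    \<open>p_n < p_n + \<epsilon> / k\<close>. This excludes \<open>k < 0\<close> and also
    \<open>k = 0\<close>, where the quotient is \<open>0\<close>.\<close>
  have "0 < \<epsilon> / k"
    using A by auto
  then have "0 < k"
    using \<open>0 < \<epsilon>\<close> by (simp add: zero_less_divide_iff)
  then have "0 < b"
    using A by (simp add: b_def)
  have p_n: "p_n = b / k" and p_n_eps: "p_n + \<epsilon> / k = (b + \<epsilon>) / k"
    using \<open>0 < k\<close> by (simp_all add: b_def field_simps)
  have mixture: "ntp_loss Pm g = \<alpha> * ntp_loss Pn g + (1 - \<alpha>) * ntp_loss Pc g" for g
    by (rule ntp_loss_mixture[of L]) (use A assms(1) in auto)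
  have loss_hstar: "ntp_loss Pn hstar = ln k - ln b"
    using A \<open>0 < k\<close> \<open>0 < b\<close> by (simp add: p_n ln_div)
  have loss_h: "ntp_loss Pn h = ln k - ln (b + \<epsilon>)"
  proof -
    have "ntp_loss Pn h = - ln ((b + \<epsilon>) / k)"
      using A by (simp add: p_n_eps)
    then show ?thesis
      using \<open>0 < k\<close> \<open>0 < b\<close> \<open>0 < \<epsilon>\<close> by (simp add: ln_div)
  qed
  \<comment> \<open>The terms \<open>ln k\<close> cancel, so \<open>k\<close> and \<open>p_n\<close>
    enter only through \<open>b\<close>.\<close>
  have diff: "ntp_loss Pm h - ntp_loss Pm hstar = excess \<alpha> p_c b \<epsilon>"
    using assms(5,8) unfolding mixture loss_hstar loss_h by (simp add: excess_def algebra_simps)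
  \<comment> \<open>Clearing the denominator turns the threshold on \<alpha> into the sign of
    \<eta>.\<close>
  have small: "\<alpha> \<le> k * p_n / (p_c + k * p_n) \<longleftrightarrow> \<eta> \<le> 0"
  proof -
    have "0 < p_c + b"
      using \<open>0 < p_c\<close> \<open>0 < b\<close> by simp
    then show ?thesis
      by (simp add: \<eta>_b pos_le_divide_eq algebra_simps flip: b_def)
  qed
  have pos: "0 < excess \<alpha> p_c b \<epsilon>" if "\<eta> \<le> 0"
    using excess_strict_increasing[of b 0 \<epsilon> p_c \<alpha>] that \<open>0 < b\<close> \<open>0 < \<epsilon>\<close> \<open>\<epsilon> < p_c\<close>
    by (simp add: \<eta>_b)
  \<comment> \<open>Past \<eta> the excess does not decrease, so its positivity at
    \<open>c * \<eta>\<close> carries over to \<epsilon>; used with \<open>c = 2\<close> and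
    \<open>c = 3\<close>.\<close>
  have large: "0 < excess \<alpha> p_c b \<epsilon>"
    if "0 < \<eta>" "0 < excess \<alpha> p_c b (c * \<eta>)" "c * \<eta> \<le> \<epsilon>" "1 \<le> c" for c
  proof -
    have "\<eta> \<le> c * \<eta>"
      using that by simp
    then have "excess \<alpha> p_c b (c * \<eta>) \<le> excess \<alpha> p_c b \<epsilon>"
      using that \<open>0 < b\<close> \<open>\<epsilon> < p_c\<close> by (intro excess_mono) (auto simp: \<eta>_b)
    with that show ?thesis by simp
  qed
  have rate: "\<epsilon> * exp (ntp_loss Pn h) \<le> k"
  proof -
    have "exp (ntp_loss Pn h) = k / (b + \<epsilon>)"
      using A \<open>0 < b\<close> \<open>0 < k\<close> \<open>0 < \<epsilon>\<close> by (simp add: p_n_eps exp_minus)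
    then show ?thesis
      using \<open>0 < b\<close> \<open>0 < k\<close> \<open>0 < \<epsilon>\<close>
      by (simp add: pos_divide_le_eq distrib_left mult.commute)
  qed
  have decrease: "excess \<alpha> p_c b \<epsilon> < 0" if "\<epsilon> < \<eta>"
    using excess_strict_decreasing[of b 0 \<epsilon> p_c \<alpha>] that \<open>0 < b\<close> \<open>0 < \<epsilon>\<close> \<open>\<epsilon> < p_c\<close>
    by (simp add: \<eta>_b)
  have triple: "0 < excess \<alpha> p_c b \<epsilon>"
    if "\<alpha> < 1 / 3" "k > \<alpha> * (1 - 3 * \<alpha>) * p_c / ((1 - \<alpha>) * (2 - 3 * \<alpha>) * p_n)" "\<epsilon> \<ge> 3 * \<eta>"
  proof (cases "0 < \<eta>")
    case True
    \<comment> \<open>Here \<open>\<alpha> < 1 / 3\<close> makes both factors positive, so the bound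
      on \<open>k\<close> can be cleared of its denominator.\<close>
    have "0 < (1 - \<alpha>) * (2 - 3 * \<alpha>) * p_n"
      using that A by (intro mult_pos_pos) auto
    then have "\<alpha> * (1 - 3 * \<alpha>) * p_c < (1 - \<alpha>) * (2 - 3 * \<alpha>) * b"
      using that(2) by (simp add: b_def pos_divide_less_eq mult_ac)
    then have "0 < excess \<alpha> p_c b (3 * \<eta>)"
      using True that \<open>0 < b\<close> \<open>0 < p_c\<close> \<open>\<epsilon> < p_c\<close> by (intro excess_triple_pos) (auto simp: \<eta>_b)
    with large[of 3] True that show ?thesis by simp
  qed (simp add: pos)
  have double: "0 < excess \<alpha> p_c b \<epsilon>" if "0 < \<eta>" "1 / 2 < \<alpha>" "2 * \<eta> \<le> \<epsilon>"
  proof -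
    have "0 < excess \<alpha> p_c b (2 * \<eta>)"
      using that \<open>0 < b\<close> \<open>0 < p_c\<close> \<open>\<epsilon> < p_c\<close> by (intro excess_double_pos) (auto simp: \<eta>_b)
    with large[of 2] that show ?thesis by simp
  qed
  \<comment> \<open>Optimality of \<open>h\<close> is applied to the single competitor
    \<open>hstar\<close>; together with \<open>double\<close> it rules out
    \<open>2 * \<eta> \<le> \<epsilon>\<close>.\<close>
  have minimizer: "ntp_loss Pm h \<le> ntp_loss Pm hstar" if "\<forall>g\<in>H. ntp_loss Pm h \<le> ntp_loss Pm g"
    using that \<open>hstar \<in> H\<close> by blast
  show "let \<eta> = \<alpha> * p_c - (1 - \<alpha>) * k * p_n in
      k \<ge> \<epsilon> * exp (ntp_loss Pn h) \<and>
      (\<alpha> \<le> k * p_n / (p_c + k * p_n) \<longrightarrow> ntp_loss Pm h \<ge> ntp_loss Pm hstar) \<and>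
      (\<alpha> > k * p_n / (p_c + k * p_n) \<longrightarrow> \<epsilon> < \<eta> \<longrightarrow> ntp_loss Pm h < ntp_loss Pm hstar) \<and>
      (\<alpha> < 1 / 3 \<longrightarrow> k > \<alpha> * (1 - 3 * \<alpha>) * p_c / ((1 - \<alpha>) * (2 - 3 * \<alpha>) * p_n) \<longrightarrow>
        \<epsilon> \<ge> 3 * \<eta> \<longrightarrow> ntp_loss Pm hstar < ntp_loss Pm h) \<and>
      (\<alpha> > max (k * p_n / (p_c + k * p_n)) (1 / 2) \<longrightarrow>
        k > (2 * \<alpha> - 1) * p_c / (2 * (1 - \<alpha>) * p_n) \<longrightarrow>
        (\<epsilon> \<ge> 2 * \<eta> \<longrightarrow> ntp_loss Pm hstar < ntp_loss Pm h) \<and>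
        ((\<forall>g\<in>H. ntp_loss Pm h \<le> ntp_loss Pm g) \<longrightarrow> \<epsilon> \<le> 2 * \<eta>))"
    unfolding Let_def \<eta>_def[symmetric]
  proof (intro conjI impI)
    assume "\<alpha> \<le> k * p_n / (p_c + k * p_n)"
    then show "ntp_loss Pm hstar \<le> ntp_loss Pm h"
      using small pos diff by simp
  next
    assume "\<epsilon> < \<eta>"
    then show "ntp_loss Pm h < ntp_loss Pm hstar"
      using decrease diff by simp
  next
    assume "\<alpha> < 1 / 3" "\<alpha> * (1 - 3 * \<alpha>) * p_c / ((1 - \<alpha>) * (2 - 3 * \<alpha>) * p_n) < k" "3 * \<eta> \<le> \<epsilon>"
    then show "ntp_loss Pm hstar < ntp_loss Pm h"
      using triple diff by simp
  next
    assume "max (k * p_n / (p_c + k * p_n)) (1 / 2) < \<alpha>"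
    then have "0 < \<eta>" "1 / 2 < \<alpha>"
      using small by auto
    then show "2 * \<eta> \<le> \<epsilon> \<Longrightarrow> ntp_loss Pm hstar < ntp_loss Pm h"
      and "\<forall>g\<in>H. ntp_loss Pm h \<le> ntp_loss Pm g \<Longrightarrow> \<epsilon> \<le> 2 * \<eta>"
      using double minimizer diff by force+
  qed (fact rate)
qed

end
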